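(* Let $(A,B)$ be a pregap in $\mathcal P(\mathbb N)/\mathrm{Fin}$. The following are equivalent: (a) $(A,B)$ is Souslin; (b) for every indexing $(a_i,b_i:i\in I)$ of representatives of $(A,B)$, the poset of all finite $L_0$-homogeneous subsets of $I$, ordered by reverse inclusion, has the countable chain condition; (c) there exists an indexing $(a_i,b_i:i\in I)$ of representatives of $(A,B)$ such that for every $k\in\mathbb N$ the poset of all finite $L^k_0$-homogeneous subsets of $I$, ordered by reverse inclusion, has the countable chain condition.
   Context: $\mathcal P(\mathbb N)/\mathrm{Fin}$ is $\mathcal P(\mathbb N)$ modulo finite symmetric difference, ordered by $[a]\subseteq^*[b]$ iff $a\setminus b$ finite. A pregap is a pair $(A,B)$ of subsets with $a\wedge b=0$ for all $a\in A$, $b\in B$. An indexing of representatives of $(A,B)$ is a family $(a_i,b_i:i\in I)$ of subsets of $\mathbb N$ with $A=\{[a_i]:i\in I\}$ and $B=\{[b_i]:i\in I\}$. For $k\in\mathbb N$ define $L^k_0\subseteq I^2$ (ordered pairs, including $(i,i)$) by $(i,j)\in L^k_0$ iff $(a_i\cap b_j\setminus k)\cup(a_j\cap b_i\setminus k)=\emptyset$, where $k=\{0,\dots,k-1\}$; $L_0=L^0_0$. A set $H\subseteq I$ is $L^k_0$-homogeneous if $H^2\subseteq L^k_0$. An element $d$ of $\mathcal P(\mathbb N)/\mathrm{Fin}$ interpolates a finite $F\subseteq A\times B$ if $a\le d$ and $b\le -d$ for all $(a,b)\in F$. $(A,B)$ is Souslin if for every uncountable family $\mathcal F$ of finite subsets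 of $A\times B$ there is an $\aleph_1$-preserving forcing extension containing some $d\in\mathcal P(\mathbb N)/\mathrm{Fin}$ such that $\{F\in\mathcal F: d\text{ interpolates }F\}$ is uncountable.
   Formalization: Assumes A is empty iff B is empty (if exactly one is empty there is no indexing, so (a) and (b) hold but (c) fails); index sets and forcing notions are taken inside arbitrary but fixed ambient collections of at least continuum size. *)

theory Defs
  imports "HOL-Library.Countable_Set"
begin

section \<open>The Boolean algebra of sets of naturals modulo finite sets\<close>

quotient_type pnfin = "nat set" / "\<lambda>a b. finite (sym_diff a b)"
  morphisms rep_pnfin cls
proof (rule equivpI)
  show "reflp (\<lambda>a b :: nat set. finite (sym_diff a b))"
    by (simp add: reflp_def)
  show "symp (\<lambda>a b :: nat set. finite (sym_diff a b))"
    by (simp add: symp_def)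
  show "transp (\<lambda>a b :: nat set. finite (sym_diff a b))"
  proof (rule transpI)
    fix a b c :: "nat set"
    assume "finite (sym_diff a b)" "finite (sym_diff b c)"
    then have "finite (sym_diff a b \<union> sym_diff b c)" by simp
    then show "finite (sym_diff a c)" by (rule rev_finite_subset) blast
  qed
qed

instantiation pnfin :: boolean_algebra
begin

lift_definition less_eq_pnfin :: "pnfin \<Rightarrow> pnfin \<Rightarrow> bool" is "\<lambda>a b. finite (a - b)"
proof -
  fix a a' b b' :: "nat set"
  assume "finite (sym_diff a a')" "finite (sym_diff b b')"
  then have fin: "finite (sym_diff a a' \<union> sym_diff b b')" by simp
  show "finite (a - b) = finite (a' - b')"
  proof
    assume "finite (a - b)"
    with fin have "finite ((a - b) \<union> (sym_diff a a' \<union> sym_diff b b'))" by simp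
    then show "finite (a' - b')" by (rule rev_finite_subset) blast
  next
    assume "finite (a' - b')"
    with fin have "finite ((a' - b') \<union> (sym_diff a a' \<union> sym_diff b b'))" by simp
    then show "finite (a - b)" by (rule rev_finite_subset) blast
  qed
qed

definition less_pnfin :: "pnfin \<Rightarrow> pnfin \<Rightarrow> bool" where
  "less_pnfin x y \<longleftrightarrow> x \<le> y \<and> \<not> y \<le> x"

lift_definition inf_pnfin :: "pnfin \<Rightarrow> pnfin \<Rightarrow> pnfin" is "(\<inter>)"
proof -
  fix a a' b b' :: "nat set"
  assume "finite (sym_diff a a')" "finite (sym_diff b b')"
  then have "finite (sym_diff a a' \<union> sym_diff b b')" by simp
  then show "finite (sym_diff (a \<inter> b) (a' \<inter> b'))" by (rule rev_finite_subset) blast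
qed

lift_definition sup_pnfin :: "pnfin \<Rightarrow> pnfin \<Rightarrow> pnfin" is "(\<union>)"
proof -
  fix a a' b b' :: "nat set"
  assume "finite (sym_diff a a')" "finite (sym_diff b b')"
  then have "finite (sym_diff a a' \<union> sym_diff b b')" by simp
  then show "finite (sym_diff (a \<union> b) (a' \<union> b'))" by (rule rev_finite_subset) blast
qed

lift_definition minus_pnfin :: "pnfin \<Rightarrow> pnfin \<Rightarrow> pnfin" is "(-)"
proof -
  fix a a' b b' :: "nat set"
  assume "finite (sym_diff a a')" "finite (sym_diff b b')"
  then have "finite (sym_diff a a' \<union> sym_diff b b')" by simp
  then show "finite (sym_diff (a - b) (a' - b'))" by (rule rev_finite_subset) blast
qed

lift_definition uminus_pnfin :: "pnfin \<Rightarrow> pnfin" is "uminus"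
proof -
  fix a a' :: "nat set"
  assume "finite (sym_diff a a')"
  then show "finite (sym_diff (- a) (- a'))" by (rule rev_finite_subset) blast
qed

lift_definition bot_pnfin :: pnfin is "{}" .

lift_definition top_pnfin :: pnfin is "UNIV" .

instance
proof
  fix x y z :: pnfin
  show "x < y \<longleftrightarrow> x \<le> y \<and> \<not> y \<le> x" by (rule less_pnfin_def)
  show "x \<le> x" by transfer simp
  show "x \<le> z" if "x \<le> y" "y \<le> z"
    using that
  proof transfer
    fix a b c :: "nat set"
    assume "finite (a - b)" "finite (b - c)"
    then have "finite ((a - b) \<union> (b - c))" by simp
    then show "finite (a - c)" by (rule rev_finite_subset) blast
  qed
  show "x = y" if "x \<le> y" "y \<le> x"
    using that by transfer simp
  show "inf x y \<le> x"
    by transfer (metis Diff_eq_empty_iff finite.emptyI inf_le1)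
  show "inf x y \<le> y"
    by transfer (metis Diff_eq_empty_iff finite.emptyI inf_le2)
  show "x \<le> inf y z" if "x \<le> y" "x \<le> z"
    using that by transfer (simp add: Diff_Int)
  show "x \<le> sup x y"
    by transfer (metis Diff_eq_empty_iff finite.emptyI sup_ge1)
  show "y \<le> sup x y"
    by transfer (metis Diff_eq_empty_iff finite.emptyI sup_ge2)
  show "sup y z \<le> x" if "y \<le> x" "z \<le> x"
    using that by transfer (simp add: Un_Diff)
  show "bot \<le> x" by transfer simp
  show "x \<le> top" by transfer simp
  show "sup x (inf y z) = inf (sup x y) (sup x z)"
    by transfer (simp add: Un_Int_distrib)
  show "inf x (- x) = bot" by transfer simp
  show "sup x (- x) = top" by transfer simp
  show "x - y = inf x (- y)" by transfer (simp add: Diff_eq)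
qed

end

section \<open>Pregaps and indexings of representatives\<close>

definition pregap :: "pnfin set \<Rightarrow> pnfin set \<Rightarrow> bool" where
  "pregap A B \<longleftrightarrow> (\<forall>a\<in>A. \<forall>b\<in>B. inf a b = bot)"

text \<open>One index set serves both sides, so a pair with exactly one empty side has no indexing. The
  hypothesis that \<open>A\<close> is empty iff \<open>B\<close> is makes indexings exist, provided that
  the index type is large enough.\<close>

definition indexing ::
  "pnfin set \<Rightarrow> pnfin set \<Rightarrow> 'i set \<Rightarrow> ('i \<Rightarrow> nat set) \<Rightarrow> ('i \<Rightarrow> nat set) \<Rightarrow> bool" where
  "indexing A B I a b \<longleftrightarrow> A = (\<lambda>i. cls (a i)) ` I \<and> B = (\<lambda>i. cls (b i)) ` I"

definition L0 ::
  "'i set \<Rightarrow> ('i \<Rightarrow> nat set) \<Rightarrow> ('i \<Rightarrow> nat set) \<Rightarrow> nat \<Rightarrow> ('i \<times> 'i) set" where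
  "L0 I a b k =
     {(i, j) \<in> I \<times> I. ((a i \<inter> b j) - {..<k}) \<union> ((a j \<inter> b i) - {..<k}) = {}}"

definition homogeneous ::
  "'i set \<Rightarrow> ('i \<Rightarrow> nat set) \<Rightarrow> ('i \<Rightarrow> nat set) \<Rightarrow> nat \<Rightarrow> 'i set \<Rightarrow> bool" where
  "homogeneous I a b k H \<longleftrightarrow> H \<subseteq> I \<and> H \<times> H \<subseteq> L0 I a b k"

section \<open>Posets\<close>

text \<open>A notion of forcing is a preorder given by its relation \<open>r\<close>: a pair \<open>(q, p) \<in> r\<close> means
  that \<open>q\<close> is stronger than \<open>p\<close> (that is, \<open>q \<le> p\<close>), and the conditions are the elements
  of \<open>Field r\<close>.\<close>

definition ccc :: "'p rel \<Rightarrow> bool" where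
  "ccc r \<longleftrightarrow>
     (\<forall>C \<subseteq> Field r.
        (\<forall>p\<in>C. \<forall>q\<in>C. p \<noteq> q \<longrightarrow> \<not> (\<exists>s. (s, p) \<in> r \<and> (s, q) \<in> r)) \<longrightarrow> countable C)"

definition homog_poset ::
  "'i set \<Rightarrow> ('i \<Rightarrow> nat set) \<Rightarrow> ('i \<Rightarrow> nat set) \<Rightarrow> nat \<Rightarrow> 'i set rel" where
  "homog_poset I a b k =
     {(H, K). finite H \<and> homogeneous I a b k H \<and> finite K \<and> homogeneous I a b k K \<and> K \<subseteq> H}"

section \<open>The forcing relation\<close>

text \<open>
  HOL has no generic extension of its universe, so statements about forcing extensions are
  expressed through the forcing relation. A statement of the forcing language over \<open>r\<close> is
  represented by the predicate ``\<open>p\<close> forces it'' on conditions, and the connectives below are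
  the recursion clauses of the forcing relation. A name for a subset of a ground model set is a
  set of pairs of a ground model element \<open>x\<close> and a condition; every subset of a ground model set
  that lies in the extension has a name of this form, so quantifying over such names amounts to
  quantifying over the subsets that the extension contains.
\<close>

type_synonym 'p stmt = "'p \<Rightarrow> bool"
type_synonym ('x, 'p) name = "('x \<times> 'p) set"

text \<open>An assertion about ground model objects that is absolute.\<close>
definition f_ground :: "bool \<Rightarrow> 'p stmt" where
  "f_ground \<phi> p \<longleftrightarrow> \<phi>"

text \<open>The conditions below some \<open>s\<close> with \<open>(x, s) \<in> \<tau>\<close> are dense below \<open>p\<close>.\<close>
definition f_mem :: "'p rel \<Rightarrow> 'x \<Rightarrow> ('x, 'p) name \<Rightarrow> 'p stmt" where
  "f_mem r x \<tau> p \<longleftrightarrow>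
     (\<forall>q. (q, p) \<in> r \<longrightarrow> (\<exists>t. (t, q) \<in> r \<and> (\<exists>s. (x, s) \<in> \<tau> \<and> (t, s) \<in> r)))"

definition f_not :: "'p rel \<Rightarrow> 'p stmt \<Rightarrow> 'p stmt" where
  "f_not r \<phi> p \<longleftrightarrow> (\<forall>q. (q, p) \<in> r \<longrightarrow> \<not> \<phi> q)"

definition f_and :: "'p stmt \<Rightarrow> 'p stmt \<Rightarrow> 'p stmt" where
  "f_and \<phi> \<psi> p \<longleftrightarrow> \<phi> p \<and> \<psi> p"

definition f_imp :: "'p rel \<Rightarrow> 'p stmt \<Rightarrow> 'p stmt \<Rightarrow> 'p stmt" where
  "f_imp r \<phi> \<psi> = f_not r (f_and \<phi> (f_not r \<psi>))"

definition f_all :: "('x \<Rightarrow> 'p stmt) \<Rightarrow> 'p stmt" where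
  "f_all \<phi> p \<longleftrightarrow> (\<forall>x. \<phi> x p)"

definition f_ex :: "'p rel \<Rightarrow> ('x \<Rightarrow> 'p stmt) \<Rightarrow> 'p stmt" where
  "f_ex r \<phi> p \<longleftrightarrow> (\<forall>q. (q, p) \<in> r \<longrightarrow> (\<exists>t. (t, q) \<in> r \<and> (\<exists>x. \<phi> x t)))"

text \<open>In the next two definitions \<open>S x\<close> is the statement that \<open>x\<close> belongs to a certain subset
  (in the extension) of a ground model set. Countability asks for a name \<open>f\<close> of (the graph of)
  an injection of that subset into the naturals.\<close>

definition f_countable :: "'p rel \<Rightarrow> ('x \<Rightarrow> 'p stmt) \<Rightarrow> 'p stmt" where
  "f_countable r S =
     f_ex r (\<lambda>f :: ('x \<times> nat, 'p) name.
       f_and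
         (f_all (\<lambda>x. f_imp r (S x) (f_ex r (\<lambda>n. f_mem r (x, n) f))))
      (f_and
         (f_all (\<lambda>x. f_all (\<lambda>m. f_all (\<lambda>n.
            f_imp r (f_and (S x) (f_and (f_mem r (x, m) f) (f_mem r (x, n) f)))
              (f_ground (m = n))))))
         (f_all (\<lambda>x. f_all (\<lambda>y. f_all (\<lambda>n.
            f_imp r (f_and (f_and (S x) (S y)) (f_and (f_mem r (x, n) f) (f_mem r (y, n) f)))
              (f_ground (x = y))))))))"

text \<open>For sets of naturals, finite means bounded.\<close>
definition f_finite :: "'p rel \<Rightarrow> (nat \<Rightarrow> 'p stmt) \<Rightarrow> 'p stmt" where
  "f_finite r S = f_ex r (\<lambda>k. f_all (\<lambda>n. f_imp r (S n) (f_ground (n < k))))"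

text \<open>\<open>cardSuc natLeq\<close> is the first uncountable cardinal of the ground model. It is preserved iff
  it is still uncountable in the extension.\<close>
definition f_aleph1_preserved :: "'p rel \<Rightarrow> 'p stmt" where
  "f_aleph1_preserved r =
     f_not r (f_countable r (\<lambda>\<xi>. f_ground (\<xi> \<in> Field (cardSuc natLeq))))"

section \<open>Souslin pregaps\<close>

text \<open>The element of the power set of the naturals modulo finite in the extension is given by a
  name \<open>d\<close> for a representative. A ground model class \<open>a\<close> stands, in the extension, for the
  class there of any of its ground model representatives \<open>x\<close>.\<close>
definition f_interpolates ::
  "'p rel \<Rightarrow> (nat, 'p) name \<Rightarrow> (pnfin \<times> pnfin) set \<Rightarrow> 'p stmt" where
  "f_interpolates r d F =
     f_all (\<lambda>(a, b). f_imp r (f_ground ((a, b) \<in> F))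
       (f_and
         (f_all (\<lambda>x. f_imp r (f_ground (cls x = a))
            (f_finite r (\<lambda>n. f_and (f_ground (n \<in> x)) (f_not r (f_mem r n d))))))
         (f_all (\<lambda>y. f_imp r (f_ground (cls y = b))
            (f_finite r (\<lambda>n. f_and (f_ground (n \<in> y)) (f_mem r n d)))))))"

text \<open>There is a forcing extension with a given property iff some condition of some notion of
  forcing forces it. As HOL cannot quantify over types, the type \<open>'p\<close> from which the
  conditions are taken is a parameter; carriers are arbitrary subsets of it, and no structure on
  the type itself is used.\<close>
definition souslin :: "'p itself \<Rightarrow> pnfin set \<Rightarrow> pnfin set \<Rightarrow> bool" where
  "souslin (_ :: 'p itself) A B \<longleftrightarrow>
     (\<forall>\<F> :: (pnfin \<times> pnfin) set set.
        (\<forall>F\<in>\<F>. finite F \<and> F \<subseteq> A \<times> B) \<and> uncountable \<F> \<longrightarrow>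
        (\<exists>(P :: 'p set) r p. preorder_on P r \<and> p \<in> P \<and>
           f_and (f_aleph1_preserved r)
             (f_ex r (\<lambda>d :: (nat, 'p) name.
                f_not r (f_countable r (\<lambda>F. f_and (f_ground (F \<in> \<F>)) (f_interpolates r d F))))) p))"

end

theory Submission
  imports Defs "HOL-Algebra.Free_Abelian_Groups"
begin

text \<open>
  (a) implies (b): an uncountable antichain of homogeneous sets yields an uncountable family of
  finite subsets of \<open>A \<times> B\<close>, since a class has only countably many representatives. Two conditions
  that are both separated by one \<open>d\<close> beyond the same \<open>k\<close> and that have the same trace below \<open>k\<close>
  are compatible, so no forcing extension has a \<open>d\<close> that interpolates uncountably many members.

  (b) implies (c): \<open>L0\<close> at \<open>k\<close> is \<open>L0\<close> at \<open>0\<close> for the representatives with \<open>{..<k}\<close> removed.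

  (c) implies (a): every finite set of indices is homogeneous for some \<open>k\<close>. Fix a \<open>k\<close> that serves
  uncountably many members of the given family and force with the poset for \<open>k\<close>. By the
  countable chain condition it preserves the first uncountable cardinal, and some condition forces
  uncountably many of these members into the generic filter, where the generic homogeneous set
  interpolates them.
\<close>

section \<open>Forcing\<close>

text \<open>Negation quantifies over all stronger conditions, so the two negations in
  \<open>f_imp\<close> become a density statement below each condition where \<open>\<phi>\<close>
  holds.\<close>

lemma f_imp_iff:
  "f_imp r \<phi> \<psi> p \<longleftrightarrow> (\<forall>q. (q, p) \<in> r \<longrightarrow> \<phi> q \<longrightarrow> (\<exists>t. (t, q) \<in> r \<and> \<psi> t))"
  unfolding f_imp_def f_not_def f_and_def by blast

lemma cccD:
  assumes "ccc r" "C \<subseteq> Field r"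
    and "\<And>p q. p \<in> C \<Longrightarrow> q \<in> C \<Longrightarrow> p \<noteq> q \<Longrightarrow> \<not> (\<exists>s. (s, p) \<in> r \<and> (s, q) \<in> r)"
  shows "countable C"
  using assms by (simp add: ccc_def)

section \<open>The forcing relation over a preorder\<close>

locale forcing =
  fixes P :: "'p set" and r :: "'p rel"
  assumes preorder: "preorder_on P r"
begin

lemma field: "(q, p) \<in> r \<Longrightarrow> q \<in> P \<and> p \<in> P"
  using preorder by (auto simp: preorder_on_def)

lemma refl: "p \<in> P \<Longrightarrow> (p, p) \<in> r"
  using preorder by (auto simp: preorder_on_def refl_on_def)

lemma trans: "(t, q) \<in> r \<Longrightarrow> (q, p) \<in> r \<Longrightarrow> (t, p) \<in> r"
  using preorder by (meson preorder_on_def transD)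

lemma Field_eq: "Field r = P"
  using field refl by (auto simp: Field_def)

lemma f_mem_mono: "f_mem r x \<tau> p \<Longrightarrow> (q, p) \<in> r \<Longrightarrow> f_mem r x \<tau> q"
  unfolding f_mem_def using trans by blast

lemma f_not_mono: "f_not r \<phi> p \<Longrightarrow> (q, p) \<in> r \<Longrightarrow> f_not r \<phi> q"
  unfolding f_not_def using trans by blast

lemma f_exI: "(\<And>q. (q, p) \<in> r \<Longrightarrow> \<exists>x. \<phi> x q) \<Longrightarrow> f_ex r \<phi> p"
  unfolding f_ex_def using field refl by meson

text \<open>Membership in a name is itself a density requirement. This is what leads from not
  forcing the negation to forcing.\<close>

lemma f_mem_regular:
  assumes "\<And>q. (q, p) \<in> r \<Longrightarrow> \<exists>t. (t, q) \<in> r \<and> f_mem r x \<tau> t"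
  shows "f_mem r x \<tau> p"
  unfolding f_mem_def
proof (intro allI impI)
  fix q assume "(q, p) \<in> r"
  then obtain t where t: "(t, q) \<in> r" "f_mem r x \<tau> t" using assms by blast
  then obtain u where "(u, t) \<in> r" "\<exists>s. (x, s) \<in> \<tau> \<and> (u, s) \<in> r"
    unfolding f_mem_def using field refl by blast
  with t trans show "\<exists>t. (t, q) \<in> r \<and> (\<exists>s. (x, s) \<in> \<tau> \<and> (t, s) \<in> r)" by blast
qed

text \<open>Passing to \<open>t\<close> replaces the forced existence of an injection by an actual
  name. Equality of ground model elements is absolute, so forced injectivity becomes outright
  equality.\<close>

lemma f_countableE:
  assumes "p \<in> P" "f_countable r S p"
  obtains t f where "(t, p) \<in> r"
    "\<And>x q. (q, t) \<in> r \<Longrightarrow> S x q \<Longrightarrow> \<exists>s n. (s, q) \<in> r \<and> f_mem r (x, n :: nat) f s"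
    "\<And>x y n q. (q, t) \<in> r \<Longrightarrow> S x q \<Longrightarrow> S y q \<Longrightarrow> f_mem r (x, n) f q \<Longrightarrow>
       f_mem r (y, n) f q \<Longrightarrow> x = (y :: 'x)"
proof -
  obtain t and f :: "('x \<times> nat, 'p) name" where t: "(t, p) \<in> r"
    and tot: "\<And>x. f_imp r (S x) (f_ex r (\<lambda>n. f_mem r (x, n) f)) t"
    and inj: "\<And>x y n. f_imp r (f_and (f_and (S x) (S y))
        (f_and (f_mem r (x, n) f) (f_mem r (y, n) f))) (f_ground (x = y)) t"
    using assms(2) refl[OF assms(1)] unfolding f_countable_def f_ex_def f_and_def f_all_def by blast
  show thesis
  proof (rule that[OF t])
    show "\<exists>s n. (s, q) \<in> r \<and> f_mem r (x, n) f s" if q: "(q, t) \<in> r" "S x q" for x q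
    proof -
      obtain u where u: "(u, q) \<in> r" "f_ex r (\<lambda>n. f_mem r (x, n) f) u"
        using tot q unfolding f_imp_iff by blast
      then obtain s n where "(s, u) \<in> r" "f_mem r (x, n) f s"
        unfolding f_ex_def using field refl by blast
      with u trans show ?thesis by blast
    qed
  qed (use inj in \<open>simp add: f_imp_iff f_and_def f_ground_def\<close>)
qed

text \<open>\<open>\<Psi> x n\<close> need not be single-valued in \<open>n\<close>: the name uses the least label.\<close>

lemma f_countableI:
  assumes p: "p \<in> P"
    and mono: "\<And>x n q s. \<Psi> x (n :: nat) q \<Longrightarrow> (s, q) \<in> r \<Longrightarrow> \<Psi> x n s"
    and tot: "\<And>x q. (q, p) \<in> r \<Longrightarrow> S x q \<Longrightarrow> \<exists>t n. (t, q) \<in> r \<and> \<Psi> x n t"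
    and inj: "\<And>x y n q. (q, p) \<in> r \<Longrightarrow> \<Psi> x n q \<Longrightarrow> \<Psi> y n q \<Longrightarrow> x = y"
  shows "f_countable r S p"
proof -
  \<comment> \<open>No condition below \<open>q\<close> admits a label smaller than
    \<open>n\<close>. In this form the label persists to stronger conditions and is unique.\<close>
  define L where "L x n q \<longleftrightarrow> \<Psi> x n q \<and> (\<forall>m<n. \<forall>s. (s, q) \<in> r \<longrightarrow> \<not> \<Psi> x m s)" for x n q
  define f where "f = {((x, n), q). L x n q}"
  have L_mono: "L x n s" if "L x n q" "(s, q) \<in> r" for x n q s
    using that mono trans unfolding L_def by blast
  have memD: "\<exists>t. (t, q) \<in> r \<and> L x n t" if "f_mem r (x, n) f q" "q \<in> P" for x n q
    using that refl L_mono unfolding f_mem_def f_def by blast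
  have memI: "f_mem r (x, n) f q" if "L x n q" for x n q
    using that L_mono field refl unfolding f_mem_def f_def by blast
  have tot': "\<exists>t n. (t, q) \<in> r \<and> L x n t" if q: "(q, p) \<in> r" "S x q" for x q
  proof -
    \<comment> \<open>The least label attained anywhere below \<open>q\<close> cannot be undercut
      below a condition that attains it.\<close>
    define m where "m = (LEAST n. \<exists>t. (t, q) \<in> r \<and> \<Psi> x n t)"
    have ex: "\<exists>n. \<exists>t. (t, q) \<in> r \<and> \<Psi> x n t" using tot q by blast
    obtain t where t: "(t, q) \<in> r" "\<Psi> x m t" using LeastI_ex[OF ex] unfolding m_def by blast
    have "\<not> \<Psi> x n s" if "n < m" "(s, t) \<in> r" for n s
      using that not_less_Least[of n "\<lambda>n. \<exists>t. (t, q) \<in> r \<and> \<Psi> x n t"] t(1) trans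
      unfolding m_def by blast
    with t show ?thesis unfolding L_def by blast
  qed
  have "f_all (\<lambda>x. f_imp r (S x) (f_ex r (\<lambda>n. f_mem r (x, n) f))) q" if q: "(q, p) \<in> r" for q
    unfolding f_all_def f_imp_iff
  proof (intro allI impI)
    fix x s assume s: "(s, q) \<in> r" "S x s"
    then obtain t n where t: "(t, s) \<in> r" "L x n t" using tot' q trans by blast
    have "f_ex r (\<lambda>n. f_mem r (x, n) f) t"
      using memI L_mono[OF t(2)] by (intro f_exI) blast
    with t show "\<exists>t. (t, s) \<in> r \<and> f_ex r (\<lambda>n. f_mem r (x, n) f) t" by blast
  qed
  moreover have "m = n" if q: "q \<in> P" "f_mem r (x, m) f q" "f_mem r (x, n) f q" for x m n q
  proof -
    obtain t where t: "(t, q) \<in> r" "L x m t" using memD q by blast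
    then obtain s where s: "(s, t) \<in> r" "L x n s"
      using memD f_mem_mono[OF q(3)] field by blast
    then have "L x m s" "(s, s) \<in> r" using L_mono[OF t(2)] field refl by auto
    with s(2) show ?thesis unfolding L_def by (metis nat_neq_iff)
  qed
  moreover have "x = y" if q: "(q, p) \<in> r" "f_mem r (x, n) f q" "f_mem r (y, n) f q" for x y n q
  proof -
    obtain t where t: "(t, q) \<in> r" "L x n t" using memD q field by blast
    then obtain s where s: "(s, t) \<in> r" "L y n s"
      using memD f_mem_mono[OF q(3)] field by blast
    then have "L x n s" using L_mono[OF t(2)] by auto
    moreover have "(s, p) \<in> r" using s t q(1) trans by blast
    ultimately show ?thesis using s(2) inj unfolding L_def by blast
  qed
  ultimately have all: "f_and (f_all (\<lambda>x. f_imp r (S x) (f_ex r (\<lambda>n. f_mem r (x, n) f))))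
      (f_and
         (f_all (\<lambda>x. f_all (\<lambda>m. f_all (\<lambda>n.
            f_imp r (f_and (S x) (f_and (f_mem r (x, m) f) (f_mem r (x, n) f)))
              (f_ground (m = n))))))
         (f_all (\<lambda>x. f_all (\<lambda>y. f_all (\<lambda>n.
            f_imp r (f_and (f_and (S x) (S y)) (f_and (f_mem r (x, n) f) (f_mem r (y, n) f)))
              (f_ground (x = y))))))) q" if q: "(q, p) \<in> r" for q
    using q
    unfolding f_and_def f_all_def f_imp_iff f_ground_def
    by (intro conjI allI impI) (meson field refl trans)+
  show ?thesis
    unfolding f_countable_def by (intro f_exI exI[of _ f] all)
qed

section \<open>Consequences of the countable chain condition\<close>

text \<open>On each fibre of \<open>c\<close>, distinct elements get incompatible conditions. So
  \<open>t\<close> is injective there with an antichain as image, and each of the countably many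
  fibres is countable.\<close>

lemma countable_if_incompatible:
  assumes "ccc r"
    and t: "\<And>x. x \<in> X \<Longrightarrow> t x \<in> P"
    and c: "countable (c ` X)"
    and inj: "\<And>x y s. x \<in> X \<Longrightarrow> y \<in> X \<Longrightarrow> c x = c y \<Longrightarrow> (s, t x) \<in> r \<Longrightarrow> (s, t y) \<in> r \<Longrightarrow> x = y"
  shows "countable X"
proof -
  have "countable {x \<in> X. c x = n}" for n
  proof -
    have "countable (t ` {x \<in> X. c x = n})"
      using \<open>ccc r\<close> t inj unfolding ccc_def Field_eq by (elim allE[of _ "t ` {x \<in> X. c x = n}"]) blast
    moreover have "inj_on t {x \<in> X. c x = n}"
      using t inj refl by (intro inj_onI) (metis (mono_tags, lifting) mem_Collect_eq)
    ultimately show ?thesis using countable_image_inj_on by blast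
  qed
  then have "countable (\<Union>n\<in>c ` X. {x \<in> X. c x = n})" using c by blast
  moreover have "(\<Union>n\<in>c ` X. {x \<in> X. c x = n}) = X" by blast
  ultimately show ?thesis by simp
qed

text \<open>For each element of the first uncountable cardinal, some condition decides its value
  under a forced injection into the naturals. Elements with the same decided value have incompatible
  conditions, so there would be only countably many elements.\<close>

lemma ccc_preserves_aleph1:
  assumes "ccc r"
  shows "f_aleph1_preserved r p"
  unfolding f_aleph1_preserved_def f_not_def
proof (intro allI impI notI)
  define W where "W = Field (cardSuc natLeq)"
  fix q assume "(q, p) \<in> r" "f_countable r (\<lambda>\<xi>. f_ground (\<xi> \<in> Field (cardSuc natLeq))) q"
  then obtain t f where t: "(t, q) \<in> r"
    and tot: "\<And>x s. (s, t) \<in> r \<Longrightarrow> x \<in> W \<Longrightarrow> \<exists>u n. (u, s) \<in> r \<and> f_mem r (x, n :: nat) f u"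
    and inj: "\<And>x y n s. (s, t) \<in> r \<Longrightarrow> x \<in> W \<Longrightarrow> y \<in> W \<Longrightarrow> f_mem r (x, n) f s \<Longrightarrow>
       f_mem r (y, n) f s \<Longrightarrow> x = y"
    using field unfolding W_def by (elim f_countableE[rotated]) (auto simp: f_ground_def)
  have "\<forall>x\<in>W. \<exists>u n. (u, t) \<in> r \<and> f_mem r (x, n) f u" using tot t field refl by blast
  then obtain u n where u: "\<And>x. x \<in> W \<Longrightarrow> (u x, t) \<in> r" "\<And>x. x \<in> W \<Longrightarrow> f_mem r (x, n x) f (u x)"
    by metis
  have "countable W"
  proof (rule countable_if_incompatible[OF \<open>ccc r\<close>, where t = u and c = n])
    show "x = y" if "x \<in> W" "y \<in> W" "n x = n y" "(s, u x) \<in> r" "(s, u y) \<in> r" for x y s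
      using that u inj f_mem_mono trans by metis
  qed (use u field in auto)
  moreover have "natLeq <o |W|"
    unfolding W_def by (meson cardSuc_Card_order cardSuc_greater card_of_Field_ordIso natLeq_Card_order
        ordIso_symmetric ordLess_ordIso_trans)
  ultimately show False
    unfolding countable_def
    by (meson card_of_nat card_of_ordLeq not_ordLess_ordLeq ordLeq_ordIso_trans subset_UNIV)
qed

text \<open>Otherwise choose a maximal antichain of conditions with names for injections; it is countable,
  and every \<open>g x\<close> is compatible with one of its members, which yields a ground model labelling.\<close>

lemma ccc_forces_uncountable:
  assumes "ccc r" "uncountable X"
    and g: "\<And>x. x \<in> X \<Longrightarrow> g x \<in> P"
    and S: "\<And>x q. x \<in> X \<Longrightarrow> (q, g x) \<in> r \<Longrightarrow> S x q"
  shows "\<exists>p\<in>P. f_not r (f_countable r S) p"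
proof (rule ccontr)
  \<comment> \<open>Below \<open>t\<close> the name \<open>f\<close> acts as an injection into the
    naturals of the set given by \<open>S\<close>. By \<open>no\<close>, such \<open>t\<close> are
    dense.\<close>
  define E where "E t f \<longleftrightarrow> t \<in> P \<and>
      (\<forall>x q. (q, t) \<in> r \<longrightarrow> S x q \<longrightarrow> (\<exists>s n. (s, q) \<in> r \<and> f_mem r (x, n :: nat) f s)) \<and>
      (\<forall>x y n q. (q, t) \<in> r \<longrightarrow> S x q \<longrightarrow> S y q \<longrightarrow> f_mem r (x, n) f q \<longrightarrow>
         f_mem r (y, n) f q \<longrightarrow> x = y)" for t f
  define D where "D = {C. C \<subseteq> {t. \<exists>f. E t f} \<and>
      (\<forall>p\<in>C. \<forall>q\<in>C. p \<noteq> q \<longrightarrow> \<not> (\<exists>s. (s, p) \<in> r \<and> (s, q) \<in> r))}"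
  assume "\<not> ?thesis"
  then have no: "\<forall>p\<in>P. \<not> f_not r (f_countable r S) p" by simp
  have dense: "\<exists>t f. (t, p) \<in> r \<and> E t f" if p: "p \<in> P" for p
  proof -
    obtain q where q: "(q, p) \<in> r" "f_countable r S q"
      using no p unfolding f_not_def by blast
    then have "q \<in> P" using field by blast
    show ?thesis
    proof (rule f_countableE[OF \<open>q \<in> P\<close> q(2)], intro exI conjI)
      fix t f assume t: "(t, q) \<in> r"
        "\<And>x s. (s, t) \<in> r \<Longrightarrow> S x s \<Longrightarrow> \<exists>u n. (u, s) \<in> r \<and> f_mem r (x, n :: nat) f u"
        "\<And>x y n s. (s, t) \<in> r \<Longrightarrow> S x s \<Longrightarrow> S y s \<Longrightarrow> f_mem r (x, n) f s \<Longrightarrow>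
           f_mem r (y, n) f s \<Longrightarrow> x = y"
      show "(t, p) \<in> r" using t(1) q(1) trans by blast
      have "t \<in> P" using t(1) field by blast
      then show "E t f" unfolding E_def using t(2,3) by simp
    qed
  qed
  have "\<exists>M\<in>D. \<forall>C\<in>D. M \<subseteq> C \<longrightarrow> C = M"
  proof (rule subset_Zorn')
    fix K assume "subset.chain D K"
    then have K: "K \<subseteq> D" "\<And>C C'. C \<in> K \<Longrightarrow> C' \<in> K \<Longrightarrow> C \<subseteq> C' \<or> C' \<subseteq> C"
      by (auto simp: subset_chain_def)
    show "\<Union>K \<in> D"
      unfolding D_def
    proof (intro CollectI conjI ballI impI)
      show "\<Union>K \<subseteq> {t. \<exists>f. E t f}" using K(1) unfolding D_def by blast
      fix p q assume "p \<in> \<Union>K" "q \<in> \<Union>K" "p \<noteq> q"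
      then obtain C where "C \<in> K" "p \<in> C" "q \<in> C" using K(2) by blast
      with K(1) \<open>p \<noteq> q\<close> show "\<not> (\<exists>s. (s, p) \<in> r \<and> (s, q) \<in> r)" unfolding D_def by blast
    qed
  qed
  then obtain M where M: "M \<in> D" "\<And>C. C \<in> D \<Longrightarrow> M \<subseteq> C \<Longrightarrow> C = M" by blast
  have "M \<subseteq> P" using M(1) unfolding D_def E_def by blast
  moreover have "\<forall>p\<in>M. \<forall>q\<in>M. p \<noteq> q \<longrightarrow> \<not> (\<exists>s. (s, p) \<in> r \<and> (s, q) \<in> r)"
    using M(1) unfolding D_def by simp
  ultimately have "countable M" using \<open>ccc r\<close> by (simp add: ccc_def Field_eq)
  obtain f where f: "\<And>t. t \<in> M \<Longrightarrow> E t (f t)" using M(1) unfolding D_def by (simp add: subset_eq) metis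
  \<comment> \<open>If \<open>p\<close> were incompatible with all of \<open>M\<close>, then so
    would be a witness \<open>t\<close> below it, and \<open>t\<close> could be added to the maximal
    \<open>M\<close>.\<close>
  have compat: "\<exists>t\<in>M. \<exists>s. (s, t) \<in> r \<and> (s, p) \<in> r" if p: "p \<in> P" for p
  proof -
    obtain t h where t: "(t, p) \<in> r" "E t h" using dense p by blast
    show ?thesis
    proof (rule ccontr)
      assume *: "\<not> ?thesis"
      then have "\<nexists>s. (s, q) \<in> r \<and> (s, t) \<in> r" if "q \<in> M" for q
        using that trans[OF _ t(1)] by blast
      then have "insert t M \<in> D" using M(1) t(2) unfolding D_def by auto
      then have "t \<in> M" using M(2) by blast
      with * t field refl show False by blast
    qed
  qed
  have "\<exists>t u n. t \<in> M \<and> (u, t) \<in> r \<and> (u, g x) \<in> r \<and> f_mem r (x, n) (f t) u" if x: "x \<in> X" for x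
  proof -
    obtain t s where s: "t \<in> M" "(s, t) \<in> r" "(s, g x) \<in> r" using compat g x by blast
    then obtain u n where "(u, s) \<in> r" "f_mem r (x, n) (f t) u"
      using f S x unfolding E_def by metis
    with s trans show ?thesis by blast
  qed
  then obtain t u n where tun: "\<And>x. x \<in> X \<Longrightarrow> t x \<in> M" "\<And>x. x \<in> X \<Longrightarrow> (u x, t x) \<in> r"
    "\<And>x. x \<in> X \<Longrightarrow> (u x, g x) \<in> r" "\<And>x. x \<in> X \<Longrightarrow> f_mem r (x, n x) (f (t x)) (u x)"
    by metis
  \<comment> \<open>The label records \<open>t x\<close> as well as \<open>n x\<close>, because
    different members of \<open>M\<close> come with unrelated names.\<close>
  have "countable X"
  proof (rule countable_if_incompatible[OF \<open>ccc r\<close>, where t = u and c = "\<lambda>x. (t x, n x)"])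
    have "(\<lambda>x. (t x, n x)) ` X \<subseteq> M \<times> UNIV" using tun(1) by blast
    then show "countable ((\<lambda>x. (t x, n x)) ` X)"
      by (rule countable_subset) (simp add: \<open>countable M\<close>)
    fix x y s
    assume *: "x \<in> X" "y \<in> X" "(t x, n x) = (t y, n y)" "(s, u x) \<in> r" "(s, u y) \<in> r"
    then have "f_mem r (x, n x) (f (t x)) s" "f_mem r (y, n x) (f (t x)) s"
      using tun(4)[of x] tun(4)[of y] f_mem_mono by auto
    moreover have "(s, t x) \<in> r" "S x s" "S y s"
      using *(1,2,4,5) tun(2,3) trans S by blast+
    ultimately show "x = y" using f[OF tun(1)] * unfolding E_def by blast
  qed (use tun(2) field in blast)
  with assms(2) show False by simp
qed

section \<open>Finiteness and interpolation in the extension\<close>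

lemma f_finiteI:
  assumes "\<And>n q. (q, p) \<in> r \<Longrightarrow> S n q \<Longrightarrow> n < k"
  shows "f_finite r S p"
  unfolding f_finite_def
proof (intro f_exI exI[of _ k])
  fix q assume "(q, p) \<in> r"
  then show "f_all (\<lambda>n. f_imp r (S n) (f_ground (n < k))) q"
    unfolding f_all_def f_imp_iff f_ground_def using assms trans field refl by meson
qed

lemma f_finiteE:
  assumes "p \<in> P" "f_finite r S p"
  obtains t k where "(t, p) \<in> r" "\<And>n q. (q, t) \<in> r \<Longrightarrow> S n q \<Longrightarrow> n < k"
proof -
  obtain t k where t: "(t, p) \<in> r" "\<And>n. f_imp r (S n) (f_ground (n < k)) t"
    using assms refl unfolding f_finite_def f_ex_def f_all_def by blast
  show thesis
    by (rule that[OF t(1)]) (use t(2) in \<open>auto simp: f_imp_iff f_ground_def\<close>)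
qed

lemma f_interpolatesI:
  assumes a: "\<And>\<alpha> \<beta> x. (\<alpha>, \<beta>) \<in> F \<Longrightarrow> cls x = \<alpha> \<Longrightarrow>
      \<exists>k. \<forall>n\<in>x. \<forall>q. (q, p) \<in> r \<longrightarrow> f_not r (f_mem r n d) q \<longrightarrow> n < k"
    and b: "\<And>\<alpha> \<beta> y. (\<alpha>, \<beta>) \<in> F \<Longrightarrow> cls y = \<beta> \<Longrightarrow>
      \<exists>k. \<forall>n\<in>y. \<forall>q. (q, p) \<in> r \<longrightarrow> f_mem r n d q \<longrightarrow> n < k"
  shows "f_interpolates r d F p"
proof -
  have fa: "f_finite r (\<lambda>n. f_and (f_ground (n \<in> x)) (f_not r (f_mem r n d))) q"
    if "(\<alpha>, \<beta>) \<in> F" "cls x = \<alpha>" and q: "(q, p) \<in> r" for \<alpha> \<beta> x q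
  proof -
    obtain k where "\<And>n q. n \<in> x \<Longrightarrow> (q, p) \<in> r \<Longrightarrow> f_not r (f_mem r n d) q \<Longrightarrow> n < k"
      using a[OF \<open>(\<alpha>, \<beta>) \<in> F\<close> \<open>cls x = \<alpha>\<close>] by blast
    then show ?thesis
      using trans[OF _ q] by (intro f_finiteI[of _ _ k]) (auto simp: f_and_def f_ground_def)
  qed
  have fb: "f_finite r (\<lambda>n. f_and (f_ground (n \<in> y)) (f_mem r n d)) q"
    if "(\<alpha>, \<beta>) \<in> F" "cls y = \<beta>" and q: "(q, p) \<in> r" for \<alpha> \<beta> y q
  proof -
    obtain k where "\<And>n q. n \<in> y \<Longrightarrow> (q, p) \<in> r \<Longrightarrow> f_mem r n d q \<Longrightarrow> n < k"
      using b[OF \<open>(\<alpha>, \<beta>) \<in> F\<close> \<open>cls y = \<beta>\<close>] by blast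
    then show ?thesis
      using trans[OF _ q] by (intro f_finiteI[of _ _ k]) (auto simp: f_and_def f_ground_def)
  qed
  have impI: "f_imp r (f_ground \<phi>) \<psi> q" if "\<And>t. \<phi> \<Longrightarrow> (t, q) \<in> r \<Longrightarrow> \<psi> t" for \<phi> \<psi> q
    unfolding f_imp_iff f_ground_def using that field refl by meson
  show ?thesis
    unfolding f_interpolates_def f_all_def split_paired_all
    by (auto simp: f_and_def intro!: impI intro: fa[OF _ HOL.refl, OF _ trans]
        fb[OF _ HOL.refl, OF _ trans])
qed

lemma f_imp_mono: "f_imp r \<phi> \<psi> p \<Longrightarrow> (q, p) \<in> r \<Longrightarrow> f_imp r \<phi> \<psi> q"
  unfolding f_imp_iff using trans by blast

lemma f_interpolates_mono:
  "f_interpolates r d F p \<Longrightarrow> (q, p) \<in> r \<Longrightarrow> f_interpolates r d F q"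
  unfolding f_interpolates_def f_all_def by (auto intro: f_imp_mono)

text \<open>Extend \<open>p\<close> to reach both finiteness statements, then to bound the part of
  \<open>x\<close> outside \<open>d\<close>, then to bound the part of \<open>y\<close> inside
  \<open>d\<close>. The larger bound serves as \<open>k\<close>.\<close>

lemma f_interpolatesE:
  assumes p: "p \<in> P" and d: "f_interpolates r d F p" and xy: "(cls x, cls y) \<in> F"
  obtains t k where "(t, p) \<in> r"
    "\<And>n. n \<in> x \<Longrightarrow> k \<le> n \<Longrightarrow> f_mem r n d t"
    "\<And>n. n \<in> y \<Longrightarrow> k \<le> n \<Longrightarrow> f_not r (f_mem r n d) t"
proof -
  let ?fa = "\<lambda>n. f_and (f_ground (n \<in> x)) (f_not r (f_mem r n d))"
  let ?fb = "\<lambda>n. f_and (f_ground (n \<in> y)) (f_mem r n d)"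
  have impD: "\<exists>t. (t, q) \<in> r \<and> \<psi> t" if "f_imp r (f_ground \<phi>) \<psi> q" "q \<in> P" \<phi> for \<phi> \<psi> q
    using that refl unfolding f_imp_iff f_ground_def by blast
  obtain p1 where p1: "(p1, p) \<in> r"
      "f_imp r (f_ground (cls x = cls x)) (f_finite r ?fa) p1"
      "f_imp r (f_ground (cls y = cls y)) (f_finite r ?fb) p1"
  proof -
    have "f_imp r (f_ground ((cls x, cls y) \<in> F))
       (f_and
         (f_all (\<lambda>z. f_imp r (f_ground (cls z = cls x))
            (f_finite r (\<lambda>n. f_and (f_ground (n \<in> z)) (f_not r (f_mem r n d))))))
         (f_all (\<lambda>z. f_imp r (f_ground (cls z = cls y))
            (f_finite r (\<lambda>n. f_and (f_ground (n \<in> z)) (f_mem r n d)))))) p"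
      using d unfolding f_interpolates_def f_all_def by (auto dest: spec2)
    from impD[OF this p xy] show thesis
      using that unfolding f_and_def f_all_def by blast
  qed
  have "p1 \<in> P" using p1 field by blast
  from impD[OF p1(2) this HOL.refl] obtain p2 where p2: "(p2, p1) \<in> r" "f_finite r ?fa p2" by blast
  then have "p2 \<in> P" using field by blast
  from f_finiteE[OF this p2(2)] obtain p3 k where p3: "(p3, p2) \<in> r"
    and k: "\<And>n q. (q, p3) \<in> r \<Longrightarrow> ?fa n q \<Longrightarrow> n < k" by metis
  have "(p3, p1) \<in> r" using p3 p2 trans by blast
  then obtain p4 where p4: "(p4, p3) \<in> r" "f_finite r ?fb p4"
    using p1(3) refl field unfolding f_imp_iff f_ground_def by blast
  then have "p4 \<in> P" using field by blast
  from f_finiteE[OF this p4(2)] obtain t l where t: "(t, p4) \<in> r"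
    and l: "\<And>n q. (q, t) \<in> r \<Longrightarrow> ?fb n q \<Longrightarrow> n < l" by metis
  have t3: "(t, p3) \<in> r" using t p4 trans by blast
  show thesis
  proof (rule that[of t "max k l"])
    show "(t, p) \<in> r" using t3 \<open>(p3, p1) \<in> r\<close> p1(1) trans by blast
    \<comment> \<open>No condition below \<open>t\<close> forces \<open>n\<close> out of
      \<open>d\<close>, so the conditions forcing it in are dense below \<open>t\<close>.\<close>
    show "f_mem r n d t" if n: "n \<in> x" "max k l \<le> n" for n
    proof (rule f_mem_regular)
      fix q assume q: "(q, t) \<in> r"
      then have "\<not> f_not r (f_mem r n d) q"
        using k[of q n] n trans[OF q t3] by (auto simp: f_and_def f_ground_def)
      then show "\<exists>s. (s, q) \<in> r \<and> f_mem r n d s" unfolding f_not_def by blast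
    qed
    show "f_not r (f_mem r n d) t" if n: "n \<in> y" "max k l \<le> n" for n
      using l n unfolding f_not_def f_and_def f_ground_def by fastforce
  qed
qed

end

section \<open>Representatives\<close>

lemma cls_eq_iff: "cls x = cls y \<longleftrightarrow> finite (sym_diff x y)"
  by (rule pnfin.abs_eq_iff)

lemma cls_rep_pnfin [simp]: "cls (rep_pnfin \<alpha>) = \<alpha>"
  by (rule Quotient_abs_rep[OF Quotient_pnfin])

lemma inf_cls_eq_bot_iff: "inf (cls x) (cls y) = bot \<longleftrightarrow> finite (x \<inter> y)"
  by (simp add: inf_pnfin.abs_eq bot_pnfin.abs_eq cls_eq_iff)

text \<open>A set in the class differs from a fixed representative by a finite set of naturals, and
  there are only countably many of those.\<close>

lemma countable_cls_fiber: "countable {x. cls x = \<alpha>}"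
proof -
  have "{x. cls x = \<alpha>} \<subseteq> sym_diff (rep_pnfin \<alpha>) ` {u. finite u}"
  proof
    fix x assume "x \<in> {x. cls x = \<alpha>}"
    then have "cls (rep_pnfin \<alpha>) = cls x" by simp
    then have "finite (sym_diff (rep_pnfin \<alpha>) x)" by (simp only: cls_eq_iff)
    moreover have "x = sym_diff (rep_pnfin \<alpha>) (sym_diff (rep_pnfin \<alpha>) x)" by blast
    ultimately show "x \<in> sym_diff (rep_pnfin \<alpha>) ` {u. finite u}" by blast
  qed
  then show ?thesis
    by (rule countable_subset) (simp add: countable_Collect_finite)
qed

text \<open>An infinite set is equinumerous with its square. The coding allows pairs of
  representatives to serve as indices.\<close>

lemma ex_inj_nat_set_pairs: "\<exists>h :: nat set \<times> nat set \<Rightarrow> nat set. inj h"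
proof -
  have "|UNIV :: (nat set \<times> nat set) set| \<le>o |UNIV :: nat set set|"
    using card_of_Times_same_infinite[of "UNIV :: nat set set"] ordIso_imp_ordLeq
    by (simp add: Finite_Set.finite_set)
  then show ?thesis unfolding card_of_ordLeq[symmetric] by blast
qed

text \<open>An infinite set has as many finite subsets as elements. This places the conditions,
  finite sets of indices, in any type that admits an injection from \<open>nat set\<close>.\<close>

lemma ex_inj_on_finite_sets_of_pairs:
  "\<exists>h :: (nat set \<times> nat set) set \<Rightarrow> nat set. inj_on h {H. finite H}"
proof -
  have "infinite (UNIV :: (nat set \<times> nat set) set)"
    by (simp add: finite_prod Finite_Set.finite_set)
  then have "Fpow (UNIV :: (nat set \<times> nat set) set) \<lesssim> (UNIV :: (nat set \<times> nat set) set)"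
    by (rule eqpoll_imp_lepoll[OF eqpoll_Fpow])
  then obtain h :: "(nat set \<times> nat set) set \<Rightarrow> nat set \<times> nat set" where
    "inj_on h {H. finite H}"
    unfolding lepoll_def Fpow_def by auto
  moreover obtain h' :: "nat set \<times> nat set \<Rightarrow> nat set" where "inj h'"
    using ex_inj_nat_set_pairs by blast
  ultimately have "inj_on (h' \<circ> h) {H. finite H}"
    by (meson comp_inj_on inj_on_subset subset_UNIV)
  then show ?thesis by blast
qed

section \<open>Homogeneous sets\<close>

lemma homogeneous_iff:
  "homogeneous I a b k H \<longleftrightarrow> H \<subseteq> I \<and> (\<forall>i\<in>H. \<forall>j\<in>H. a i \<inter> b j \<subseteq> {..<k})"
  unfolding homogeneous_def L0_def by blast

lemma homogeneous_subset: "homogeneous I a b k H \<Longrightarrow> K \<subseteq> H \<Longrightarrow> homogeneous I a b k K"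
  unfolding homogeneous_iff by blast

lemma homog_poset_iff:
  "(H, K) \<in> homog_poset I a b k \<longleftrightarrow> finite H \<and> homogeneous I a b k H \<and> K \<subseteq> H"
  unfolding homog_poset_def using homogeneous_subset finite_subset by blast

lemma Field_homog_poset: "Field (homog_poset I a b k) = {H. finite H \<and> homogeneous I a b k H}"
  using homogeneous_subset finite_subset
  by (fastforce simp: Field_def homog_poset_iff Domain_iff Range_iff)

text \<open>The union is the weakest candidate for a common extension.\<close>

lemma homog_poset_compatible_iff:
  assumes "finite H" "finite K"
  shows "(\<exists>s. (s, H) \<in> homog_poset I a b k \<and> (s, K) \<in> homog_poset I a b k)
    \<longleftrightarrow> homogeneous I a b k (H \<union> K)"
proof
  assume "\<exists>s. (s, H) \<in> homog_poset I a b k \<and> (s, K) \<in> homog_poset I a b k"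
  then obtain s where "homogeneous I a b k s" "H \<union> K \<subseteq> s" by (auto simp: homog_poset_iff)
  then show "homogeneous I a b k (H \<union> K)" by (rule homogeneous_subset)
next
  assume "homogeneous I a b k (H \<union> K)"
  with assms show "\<exists>s. (s, H) \<in> homog_poset I a b k \<and> (s, K) \<in> homog_poset I a b k"
    by (intro exI[of _ "H \<union> K"]) (simp add: homog_poset_iff)
qed

lemma homog_poset_truncate:
  "homog_poset I a b k = homog_poset I (\<lambda>i. a i - {..<k}) (\<lambda>i. b i - {..<k}) 0"
proof -
  have "homogeneous I a b k = homogeneous I (\<lambda>i. a i - {..<k}) (\<lambda>i. b i - {..<k}) 0"
    unfolding homogeneous_iff fun_eq_iff by blast
  then show ?thesis unfolding homog_poset_def by simp
qed

lemma cls_truncate: "cls (x - {..<k}) = cls x"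
proof -
  have "sym_diff (x - {..<k}) x \<subseteq> {..<k}" by blast
  then show ?thesis unfolding cls_eq_iff by (rule finite_subset) simp
qed

lemma indexing_truncate:
  "indexing A B I a b \<Longrightarrow> indexing A B I (\<lambda>i. a i - {..<k}) (\<lambda>i. b i - {..<k})"
  by (simp add: indexing_def cls_truncate)

text \<open>The index set codes \<open>A \<times> B\<close> through chosen representatives. Both
  projections are onto because neither side is empty without the other.\<close>

lemma ex_indexing:
  assumes "A = {} \<longleftrightarrow> B = {}" "\<exists>f :: nat set \<Rightarrow> 'i. inj f"
  shows "\<exists>(I :: 'i set) a b. indexing A B I a b"
proof -
  obtain f :: "nat set \<Rightarrow> 'i" where "inj f" using assms(2) by blast
  moreover obtain h :: "nat set \<times> nat set \<Rightarrow> nat set" where "inj h"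
    using ex_inj_nat_set_pairs by blast
  ultimately have inj: "inj (f \<circ> h)" by (rule inj_compose)
  define u where "u = inv_into UNIV (f \<circ> h)"
  have u: "u (f (h z)) = z" for z using inv_f_f[OF inj, of z] by (simp add: u_def)
  define I where "I = (f \<circ> h) ` (rep_pnfin ` A \<times> rep_pnfin ` B)"
  have "fst ` (A \<times> B) = A" "snd ` (A \<times> B) = B" using assms(1) by auto
  moreover have "(\<lambda>i. cls (fst (u i))) ` I = fst ` (A \<times> B)"
      "(\<lambda>i. cls (snd (u i))) ` I = snd ` (A \<times> B)"
    unfolding I_def by (force simp: u image_iff)+
  ultimately have "indexing A B I (\<lambda>i. fst (u i)) (\<lambda>i. snd (u i))"
    unfolding indexing_def by simp
  then show ?thesis by blast
qed

section \<open>Souslin pregaps and the countable chain condition\<close>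

text \<open>A point of \<open>a i \<inter> b j\<close> at or above \<open>k\<close> is excluded by
  \<open>sep\<close>. Below \<open>k\<close>, both indices can be replaced by indices in
  \<open>H\<close> with the same traces, so the point would contradict the homogeneity of
  \<open>H\<close>.\<close>

lemma homogeneous_Un:
  assumes H: "homogeneous I a b 0 H" and K: "homogeneous I a b 0 K"
    and tr: "(\<lambda>i. (a i \<inter> {..<k}, b i \<inter> {..<k})) ` H = (\<lambda>i. (a i \<inter> {..<k}, b i \<inter> {..<k})) ` K"
    and sep: "\<And>i j n. i \<in> H \<union> K \<Longrightarrow> j \<in> H \<union> K \<Longrightarrow> n \<in> a i \<Longrightarrow> n \<in> b j \<Longrightarrow> k \<le> n \<Longrightarrow> False"
  shows "homogeneous I a b 0 (H \<union> K)"
proof -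
  have rep: "\<exists>l\<in>H. a i \<inter> {..<k} = a l \<inter> {..<k} \<and> b i \<inter> {..<k} = b l \<inter> {..<k}"
    if i: "i \<in> H \<union> K" for i
  proof -
    have "(a i \<inter> {..<k}, b i \<inter> {..<k}) \<in> (\<lambda>i. (a i \<inter> {..<k}, b i \<inter> {..<k})) ` H"
      using i tr by blast
    then show ?thesis by auto
  qed
  have "False" if ij: "i \<in> H \<union> K" "j \<in> H \<union> K" "n \<in> a i" "n \<in> b j" for i j n
  proof (cases "k \<le> n")
    case True
    with sep ij show False by blast
  next
    case False
    obtain i' where i': "i' \<in> H" "a i \<inter> {..<k} = a i' \<inter> {..<k}" using rep[OF ij(1)] by blast
    obtain j' where j': "j' \<in> H" "b j \<inter> {..<k} = b j' \<inter> {..<k}" using rep[OF ij(2)] by blast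
    have "n \<in> a i \<inter> {..<k}" "n \<in> b j \<inter> {..<k}" using ij(3,4) False by auto
    then have "n \<in> a i'" "n \<in> b j'" unfolding i'(2) j'(2) by auto
    with i'(1) j'(1) show False using H unfolding homogeneous_iff by blast
  qed
  then show ?thesis using H K unfolding homogeneous_iff by blast
qed

text \<open>Two members with the same pairs of representatives have a homogeneous union, so they are
  equal even if the indexing is not injective. Countably many sets of pairs of classes leave only
  countably many finite sets of pairs of representatives.\<close>

lemma countable_homogeneous_antichain:
  assumes C: "\<And>H. H \<in> C \<Longrightarrow> finite H \<and> homogeneous I a b 0 H"
    and anti: "\<And>H K. H \<in> C \<Longrightarrow> K \<in> C \<Longrightarrow> homogeneous I a b 0 (H \<union> K) \<Longrightarrow> H = K"
    and F: "countable ((\<lambda>H. (\<lambda>i. (cls (a i), cls (b i))) ` H) ` C)"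
  shows "countable C"
proof -
  let ?T = "\<Union>F\<in>(\<lambda>H. (\<lambda>i. (cls (a i), cls (b i))) ` H) ` C.
      \<Union>(\<alpha>, \<beta>)\<in>F. {x. cls x = \<alpha>} \<times> {y. cls y = \<beta>}"
  have "countable ?T"
  proof (intro countable_UN[OF F])
    fix F assume "F \<in> (\<lambda>H. (\<lambda>i. (cls (a i), cls (b i))) ` H) ` C"
    then have "countable F" using C countable_finite by blast
    then show "countable (\<Union>(\<alpha>, \<beta>)\<in>F. {x. cls x = \<alpha>} \<times> {y. cls y = \<beta>})"
      by (intro countable_UN) (auto intro: countable_cls_fiber)
  qed
  then have "countable {T. finite T \<and> T \<subseteq> ?T}" by (rule countable_Collect_finite_subset)
  moreover have "(\<lambda>H. (\<lambda>i. (a i, b i)) ` H) ` C \<subseteq> {T. finite T \<and> T \<subseteq> ?T}"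
    using C by (auto simp: image_iff)
  ultimately have "countable ((\<lambda>H. (\<lambda>i. (a i, b i)) ` H) ` C)" by (rule countable_subset[rotated])
  moreover have "inj_on (\<lambda>H. (\<lambda>i. (a i, b i)) ` H) C"
  proof (rule inj_onI)
    fix H K assume HK: "H \<in> C" "K \<in> C" and eq: "(\<lambda>i. (a i, b i)) ` H = (\<lambda>i. (a i, b i)) ` K"
    have rep: "\<exists>l\<in>H. a i = a l \<and> b i = b l" if i: "i \<in> H \<union> K" for i
    proof -
      have "(a i, b i) \<in> (\<lambda>i. (a i, b i)) ` H" using i eq by blast
      then show ?thesis by auto
    qed
    have "a i \<inter> b j \<subseteq> {..<0}" if "i \<in> H \<union> K" "j \<in> H \<union> K" for i j
      using rep[OF that(1)] rep[OF that(2)] C[OF HK(1)] unfolding homogeneous_iff by metis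
    then have "homogeneous I a b 0 (H \<union> K)" using C HK unfolding homogeneous_iff by blast
    with anti HK show "H = K" by blast
  qed
  ultimately show ?thesis by (rule countable_image_inj_on)
qed

text \<open>Each interpolated set is labelled by a bound \<open>k\<close> beyond which
  \<open>d\<close> separates a corresponding antichain member, together with the trace of that
  member below \<open>k\<close>. By \<open>homogeneous_Un\<close>, equal labels give compatible
  members, so countability is forced where uncountability was forced.\<close>

lemma souslin_imp_ccc:
  assumes souslin: "souslin TYPE('p) A B" and ind: "indexing A B I a b"
  shows "ccc (homog_poset I a b 0)"
  unfolding ccc_def Field_homog_poset
proof (intro allI impI, rule ccontr)
  fix C assume C: "C \<subseteq> {H. finite H \<and> homogeneous I a b 0 H}"
    and antichain: "\<forall>H\<in>C. \<forall>K\<in>C. H \<noteq> K \<longrightarrow>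
      \<not> (\<exists>s. (s, H) \<in> homog_poset I a b 0 \<and> (s, K) \<in> homog_poset I a b 0)"
    and "uncountable C"
  have C': "finite H" "homogeneous I a b 0 H" if "H \<in> C" for H using C that by auto
  have anti: "H = K" if "H \<in> C" "K \<in> C" "homogeneous I a b 0 (H \<union> K)" for H K
    using that antichain C' homog_poset_compatible_iff by metis
  define F where "F H = (\<lambda>i. (cls (a i), cls (b i))) ` H" for H
  have unc: "uncountable (F ` C)"
    using countable_homogeneous_antichain[of C I a b] C' anti \<open>uncountable C\<close> unfolding F_def by blast
  have "finite (F H) \<and> F H \<subseteq> A \<times> B" if "H \<in> C" for H
    using C'[OF that] ind unfolding F_def indexing_def homogeneous_def by auto
  with unc have "(\<forall>G\<in>F ` C. finite G \<and> G \<subseteq> A \<times> B) \<and> uncountable (F ` C)" by simp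
  from souslin[unfolded souslin_def f_and_def, rule_format, OF this]
  obtain P and r :: "'p rel" and p where "preorder_on P r" "p \<in> P"
    and p: "f_ex r (\<lambda>d :: (nat, 'p) name.
        f_not r (f_countable r (\<lambda>G. f_and (f_ground (G \<in> F ` C)) (f_interpolates r d G)))) p"
    unfolding f_and_def by blast
  interpret forcing P r by unfold_locales fact
  obtain t and d :: "(nat, 'p) name" where "(t, p) \<in> r"
    and t: "f_not r (f_countable r (\<lambda>G. f_and (f_ground (G \<in> F ` C)) (f_interpolates r d G))) t"
    using p refl[OF \<open>p \<in> P\<close>] unfolding f_ex_def by blast
  then have "t \<in> P" using field by blast
  \<comment> \<open>Several members of \<open>C\<close> may induce the same set of pairs of classes;
    one is chosen for each.\<close>
  define E where "E G = (SOME H. H \<in> C \<and> F H = G)" for G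
  have E: "E G \<in> C \<and> F (E G) = G" if "G \<in> F ` C" for G
    unfolding E_def by (rule someI_ex) (use that in blast)
  define sep where "sep k H q \<longleftrightarrow> (\<forall>i\<in>H. \<forall>n\<ge>k. (n \<in> a i \<longrightarrow> f_mem r n d q) \<and>
      (n \<in> b i \<longrightarrow> f_not r (f_mem r n d) q))" for k H q
  define tr where "tr k H = (\<lambda>i. (a i \<inter> {..<k}, b i \<inter> {..<k})) ` H" for k :: nat and H
  \<comment> \<open>All possible labels. Each bound admits finitely many traces, so
    \<open>to_nat_on W\<close> codes labels as naturals.\<close>
  define W where "W = (SIGMA k : (UNIV :: nat set). Pow (Pow {..<k} \<times> Pow {..<k}))"
  have "countable W"
    unfolding W_def by (rule countable_SIGMA) (auto intro: countable_finite)
  have tr_W: "(k, tr k H) \<in> W" for k H unfolding tr_def W_def by auto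
  have sep_mono: "sep l H s" if sep: "sep k H q" and s: "(s, q) \<in> r" and kl: "k \<le> l" for k l H q s
    unfolding sep_def
  proof (intro ballI allI impI conjI)
    fix i n assume "i \<in> H" "l \<le> n"
    then have "n \<in> a i \<Longrightarrow> f_mem r n d q" "n \<in> b i \<Longrightarrow> f_not r (f_mem r n d) q"
      using sep kl unfolding sep_def by auto
    then show "n \<in> a i \<Longrightarrow> f_mem r n d s" "n \<in> b i \<Longrightarrow> f_not r (f_mem r n d) s"
      using f_mem_mono[OF _ s] f_not_mono[OF _ s] by auto
  qed
  \<comment> \<open>The finitely many indices are treated one at a time, strengthening the condition
    and raising the bound; earlier separations survive by \<open>sep_mono\<close>.\<close>
  have sep_ex: "\<exists>s k. (s, q) \<in> r \<and> sep k H s"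
    if q: "q \<in> P" "f_interpolates r d (F K) q" and H: "finite H" "H \<subseteq> K" for q H K
    using H
  proof (induction H)
    case empty
    show ?case using refl[OF \<open>q \<in> P\<close>] unfolding sep_def by blast
  next
    case (insert i H)
    then obtain s k where s: "(s, q) \<in> r" "sep k H s" by blast
    then have "s \<in> P" using field by blast
    have "(cls (a i), cls (b i)) \<in> F K" using insert.prems unfolding F_def by blast
    then obtain u l where u: "(u, s) \<in> r"
        "\<And>n. n \<in> a i \<Longrightarrow> l \<le> n \<Longrightarrow> f_mem r n d u"
        "\<And>n. n \<in> b i \<Longrightarrow> l \<le> n \<Longrightarrow> f_not r (f_mem r n d) u"
      using f_interpolatesE[OF \<open>s \<in> P\<close> f_interpolates_mono[OF q(2) s(1)]] by metis
    have "sep (max k l) H u" using sep_mono[OF s(2) u(1)] by simp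
    then have "sep (max k l) (insert i H) u" using u(2,3) unfolding sep_def by simp
    moreover have "(u, q) \<in> r" using u(1) s(1) trans by blast
    ultimately show ?case by blast
  qed
  have "f_countable r (\<lambda>G. f_and (f_ground (G \<in> F ` C)) (f_interpolates r d G)) t"
  proof (rule f_countableI[OF \<open>t \<in> P\<close>])
    \<comment> \<open>A set can have several labels at one condition, since any larger bound
      separates as well.\<close>
    let ?\<Psi> = "\<lambda>G n q. G \<in> F ` C \<and> (\<exists>k. sep k (E G) q \<and> to_nat_on W (k, tr k (E G)) = n)"
    show "?\<Psi> G n s" if "?\<Psi> G n q" "(s, q) \<in> r" for G n q s
      using that sep_mono by blast
    show "\<exists>s n. (s, q) \<in> r \<and> ?\<Psi> G n s"
      if "(q, t) \<in> r" "f_and (f_ground (G \<in> F ` C)) (f_interpolates r d G) q" for G q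
    proof -
      have G: "G \<in> F ` C" "f_interpolates r d (F (E G)) q"
        using that E unfolding f_and_def f_ground_def by auto
      have "q \<in> P" using that field by blast
      from sep_ex[OF this G(2) C'(1)] E[OF G(1)] show ?thesis using G(1) by blast
    qed
    show "G = G'" if "(q, t) \<in> r" and G: "?\<Psi> G n q" "?\<Psi> G' n q" for G G' n q
    proof -
      obtain k where k: "sep k (E G) q" "to_nat_on W (k, tr k (E G)) = n" using G by blast
      obtain k' where k': "sep k' (E G') q" "to_nat_on W (k', tr k' (E G')) = n" using G by blast
      have eq: "k' = k" "tr k (E G) = tr k (E G')"
        using k(2) k'(2) to_nat_on_inj[OF \<open>countable W\<close> tr_W tr_W] by auto
      have "(q, q) \<in> r" using that(1) field refl by blast
      have "homogeneous I a b 0 (E G \<union> E G')"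
      proof (rule homogeneous_Un)
        show "homogeneous I a b 0 (E G)" "homogeneous I a b 0 (E G')" using C' E G by auto
        show "(\<lambda>i. (a i \<inter> {..<k}, b i \<inter> {..<k})) ` E G = (\<lambda>i. (a i \<inter> {..<k}, b i \<inter> {..<k})) ` E G'"
          using eq(2) unfolding tr_def .
        fix i j n
        assume "i \<in> E G \<union> E G'" "j \<in> E G \<union> E G'" "n \<in> a i" "n \<in> b j" "k \<le> n"
        then have "f_mem r n d q" "f_not r (f_mem r n d) q"
          using k(1) k'(1) unfolding sep_def eq(1) by auto
        with \<open>(q, q) \<in> r\<close> show False unfolding f_not_def by blast
      qed
      then have "E G = E G'" using anti E G by blast
      then show "G = G'" using E G by metis
    qed
  qed
  with t refl[OF \<open>t \<in> P\<close>] show False unfolding f_not_def by blast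
qed

text \<open>The name \<open>d\<close> denotes the union of the \<open>a i\<close> beyond \<open>k\<close> for \<open>i\<close> in the generic homogeneous
  set. To fit the poset into the type \<open>'p\<close>, keep only one index for each pair of
  representatives.\<close>

lemma ccc_imp_souslin:
  assumes "pregap A B" and "\<exists>g :: nat set \<Rightarrow> 'p. inj g"
    and ind: "indexing A B (I :: 'i set) a b" and ccc: "\<And>k. ccc (homog_poset I a b k)"
  shows "souslin TYPE('p) A B"
  unfolding souslin_def
proof (rule allI, rule impI)
  fix \<F> :: "(pnfin \<times> pnfin) set set"
  assume "(\<forall>F\<in>\<F>. finite F \<and> F \<subseteq> A \<times> B) \<and> uncountable \<F>"
  then have \<F>: "\<forall>F\<in>\<F>. finite F \<and> F \<subseteq> A \<times> B" and "uncountable \<F>" by auto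
  have "\<exists>J\<subseteq>I. inj_on (\<lambda>i. (a i, b i)) J \<and> (\<lambda>i. (a i, b i)) ` I = (\<lambda>i. (a i, b i)) ` J"
    using subset_refl by (rule subset_image_inj[THEN iffD1])
  then obtain J where J: "J \<subseteq> I" "inj_on (\<lambda>i. (a i, b i)) J"
      "(\<lambda>i. (a i, b i)) ` I = (\<lambda>i. (a i, b i)) ` J" by (elim exE conjE)
  have "\<exists>i\<in>J. cls (a i) = \<alpha>" if \<alpha>: "\<alpha> \<in> A" for \<alpha>
  proof -
    obtain i where i: "i \<in> I" "\<alpha> = cls (a i)" using \<alpha> ind unfolding indexing_def by blast
    then have "(a i, b i) \<in> (\<lambda>i. (a i, b i)) ` J" using J(3) by blast
    then show ?thesis using i by auto
  qed
  then obtain ia where ia: "\<And>\<alpha>. \<alpha> \<in> A \<Longrightarrow> ia \<alpha> \<in> J" "\<And>\<alpha>. \<alpha> \<in> A \<Longrightarrow> cls (a (ia \<alpha>)) = \<alpha>"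
    by metis
  have "\<exists>i\<in>J. cls (b i) = \<beta>" if \<beta>: "\<beta> \<in> B" for \<beta>
  proof -
    obtain i where i: "i \<in> I" "\<beta> = cls (b i)" using \<beta> ind unfolding indexing_def by blast
    then have "(a i, b i) \<in> (\<lambda>i. (a i, b i)) ` J" using J(3) by blast
    then show ?thesis using i by auto
  qed
  then obtain ib where ib: "\<And>\<beta>. \<beta> \<in> B \<Longrightarrow> ib \<beta> \<in> J" "\<And>\<beta>. \<beta> \<in> B \<Longrightarrow> cls (b (ib \<beta>)) = \<beta>"
    by metis
  \<comment> \<open>One index for each class occurring in \<open>F\<close>: a homogeneous set
    containing \<open>G F\<close> carries representatives of all of them.\<close>
  define G where "G F = ia ` fst ` F \<union> ib ` snd ` F" for F
  have G: "finite (G F)" "G F \<subseteq> J" if "F \<in> \<F>" for F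
  proof -
    have "finite F" "fst ` F \<subseteq> A" "snd ` F \<subseteq> B" using \<F> that by force+
    then show "finite (G F)" "G F \<subseteq> J" using ia(1) ib(1) unfolding G_def by auto
  qed

  \<comment> \<open>In a pregap all the intersections are finite, and finitely many of them have a
    common bound.\<close>
  have "\<exists>k. homogeneous I a b k (G F)" if F: "F \<in> \<F>" for F
  proof -
    have fin: "finite (a i \<inter> b j)" if "i \<in> I" "j \<in> I" for i j
      using that \<open>pregap A B\<close> ind unfolding pregap_def indexing_def inf_cls_eq_bot_iff[symmetric] by blast
    have "finite (\<Union>i\<in>G F. \<Union>j\<in>G F. a i \<inter> b j)"
      using G[OF F] J(1) by (intro finite_UN_I fin) auto
    then obtain k where "(\<Union>i\<in>G F. \<Union>j\<in>G F. a i \<inter> b j) \<subseteq> {..<k}"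
      using finite_nat_iff_bounded by blast
    moreover have "G F \<subseteq> I" using G[OF F] J(1) by blast
    ultimately have "homogeneous I a b k (G F)" unfolding homogeneous_iff by blast
    then show ?thesis by blast
  qed
  then have eq: "(\<Union>k. {F \<in> \<F>. homogeneous I a b k (G F)}) = \<F>" by blast
  have "\<exists>k. uncountable {F \<in> \<F>. homogeneous I a b k (G F)}"
  proof (rule ccontr)
    assume "\<not> ?thesis"
    then have "countable (\<Union>k. {F \<in> \<F>. homogeneous I a b k (G F)})" by (intro countable_UN) auto
    with \<open>uncountable \<F>\<close> show False unfolding eq by simp
  qed
  then obtain k where unc: "uncountable {F \<in> \<F>. homogeneous I a b k (G F)}" by blast

  \<comment> \<open>The poset for \<open>k\<close> inside \<open>'p\<close>\<close>
  \<comment> \<open>A finite subset of \<open>J\<close> is recovered from its set of pairs of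
    representatives, which is coded by a set of naturals and then sent to \<open>'p\<close>.\<close>
  obtain e :: "'i set \<Rightarrow> 'p" where e: "inj_on e {H. finite H \<and> H \<subseteq> J}"
  proof -
    obtain g :: "nat set \<Rightarrow> 'p" where "inj g" using assms(2) by blast
    obtain h :: "(nat set \<times> nat set) set \<Rightarrow> nat set" where h: "inj_on h {H. finite H}"
      using ex_inj_on_finite_sets_of_pairs by blast
    have "inj_on (\<lambda>H. g (h ((\<lambda>i. (a i, b i)) ` H))) {H. finite H \<and> H \<subseteq> J}"
    proof (rule inj_onI)
      fix H K assume HK: "H \<in> {H. finite H \<and> H \<subseteq> J}" "K \<in> {H. finite H \<and> H \<subseteq> J}"
        and "g (h ((\<lambda>i. (a i, b i)) ` H)) = g (h ((\<lambda>i. (a i, b i)) ` K))"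
      then have "h ((\<lambda>i. (a i, b i)) ` H) = h ((\<lambda>i. (a i, b i)) ` K)" using \<open>inj g\<close> by (simp add: inj_eq)
      then have "(\<lambda>i. (a i, b i)) ` H = (\<lambda>i. (a i, b i)) ` K" using HK by (intro inj_onD[OF h]) auto
      then show "H = K" using HK inj_on_image_eq_iff[OF J(2)] by blast
    qed
    then show thesis by (rule that)
  qed

  define Q where "Q = {H. finite H \<and> H \<subseteq> J \<and> homogeneous I a b k H}"
  have Q_inj: "H = K" if "H \<in> Q" "K \<in> Q" "e H = e K" for H K
    using that inj_onD[OF e] unfolding Q_def by blast
  define r where "r = {(e H, e K) | H K. H \<in> Q \<and> K \<in> Q \<and> K \<subseteq> H}"
  have rI: "(e H, e K) \<in> r" if "H \<in> Q" "K \<in> Q" "K \<subseteq> H" for H K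
    using that unfolding r_def by blast
  have rE: "\<exists>H\<in>Q. q = e H \<and> K \<subseteq> H" if qK: "(q, e K) \<in> r" "K \<in> Q" for q K
  proof -
    obtain H K' where "q = e H" "e K = e K'" "H \<in> Q" "K' \<in> Q" "K' \<subseteq> H"
      using qK(1) unfolding r_def by blast
    then show ?thesis using Q_inj qK(2) by blast
  qed
  have "preorder_on (e ` Q) r"
    unfolding preorder_on_def
  proof (intro conjI)
    show "r \<subseteq> e ` Q \<times> e ` Q" unfolding r_def by blast
    show "refl_on (e ` Q) r" using rI unfolding refl_on_def by blast
    show "trans r"
    proof (rule transI)
      fix x y z assume xy: "(x, y) \<in> r" and "(y, z) \<in> r"
      then obtain K L where KL: "y = e K" "z = e L" "K \<in> Q" "L \<in> Q" "L \<subseteq> K"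
        unfolding r_def by blast
      then obtain H where "H \<in> Q" "x = e H" "K \<subseteq> H" using rE xy by blast
      with KL show "(x, z) \<in> r" using rI[of H L] by blast
    qed
  qed
  then interpret forcing "e ` Q" r by unfold_locales
  \<comment> \<open>Antichains pull back along \<open>e\<close>: if two sets in \<open>Q\<close> are
    compatible in the poset on \<open>I\<close>, their union stays within \<open>J\<close> and is
    again in \<open>Q\<close>.\<close>
  have "ccc r"
    unfolding ccc_def Field_eq
  proof (intro allI impI)
    fix C assume C: "C \<subseteq> e ` Q"
      and anti: "\<forall>p\<in>C. \<forall>q\<in>C. p \<noteq> q \<longrightarrow> \<not> (\<exists>s. (s, p) \<in> r \<and> (s, q) \<in> r)"
    define D where "D = {H \<in> Q. e H \<in> C}"
    have "countable D"
      using ccc[of k]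
    proof (rule cccD)
      show "D \<subseteq> Field (homog_poset I a b k)" unfolding D_def Q_def Field_homog_poset by blast
      fix H K assume HK: "H \<in> D" "K \<in> D" "H \<noteq> K"
      show "\<not> (\<exists>s. (s, H) \<in> homog_poset I a b k \<and> (s, K) \<in> homog_poset I a b k)"
      proof
        assume "\<exists>s. (s, H) \<in> homog_poset I a b k \<and> (s, K) \<in> homog_poset I a b k"
        then have "H \<union> K \<in> Q"
          using HK homog_poset_compatible_iff[of H K I a b k] unfolding D_def Q_def by blast
        then have "(e (H \<union> K), e H) \<in> r" "(e (H \<union> K), e K) \<in> r"
          using HK unfolding D_def by (auto intro: rI)
        moreover have "e H \<noteq> e K" using HK Q_inj unfolding D_def by blast
        ultimately show False using anti HK unfolding D_def by blast
      qed
    qed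
    moreover have "C = e ` D" using C unfolding D_def by blast
    ultimately show "countable C" by simp
  qed

  \<comment> \<open>The generic interpolating set\<close>
  define d where "d = {(n, e H) | n H. H \<in> Q \<and> (\<exists>i\<in>H. n \<in> a i \<and> k \<le> n)}"
  have memI: "f_mem r n d (e H)" if H: "H \<in> Q" "i \<in> H" "n \<in> a i" "k \<le> n" for n H i
    unfolding f_mem_def
  proof (intro allI impI)
    fix q assume q: "(q, e H) \<in> r"
    then have "(q, q) \<in> r" using field refl by blast
    moreover have "(n, e H) \<in> d" using H unfolding d_def by blast
    ultimately show "\<exists>t. (t, q) \<in> r \<and> (\<exists>s. (n, s) \<in> d \<and> (t, s) \<in> r)" using q by blast
  qed
  \<comment> \<open>A condition forcing \<open>n\<close> into \<open>d\<close> extends to one that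
    contains \<open>j\<close> and some \<open>i\<close> with \<open>n \<in> a i\<close>; homogeneity
    for \<open>k\<close> then bounds \<open>n\<close>.\<close>
  have not_mem: "n < k" if H: "H \<in> Q" "j \<in> H" "n \<in> b j" "f_mem r n d (e H)" for n H j
  proof -
    obtain t s where t: "(t, e H) \<in> r" "(n, s) \<in> d" "(t, s) \<in> r"
      using H(1,4) refl unfolding f_mem_def by blast
    obtain K i where K: "s = e K" "K \<in> Q" "i \<in> K" "n \<in> a i" using t(2) unfolding d_def by blast
    obtain L where L: "L \<in> Q" "t = e L" "H \<subseteq> L" using rE t(1) H(1) by blast
    then have "K \<subseteq> L" using rE[of t K] t(3) K Q_inj by blast
    then have "i \<in> L" "j \<in> L" using K L H by auto
    with L(1) H(3) K(4) show ?thesis unfolding Q_def homogeneous_iff by blast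
  qed

  \<comment> \<open>An arbitrary representative exceeds the chosen one only below some
    \<open>m\<close>, and \<open>d\<close> treats the chosen ones correctly from \<open>k\<close>
    on. Hence the bound \<open>max k m\<close>.\<close>
  have interp: "f_interpolates r d F q"
    if F: "F \<in> \<F>" and GQ: "G F \<in> Q" and q: "(q, e (G F)) \<in> r" for F q
  proof -
    obtain H where H: "H \<in> Q" "q = e H" "G F \<subseteq> H" using rE q GQ by blast
    show ?thesis
    proof (rule f_interpolatesI)
      fix \<alpha> \<beta> x assume \<alpha>: "(\<alpha>, \<beta>) \<in> F" "cls x = \<alpha>"
      then have "\<alpha> \<in> A" using \<F> F by blast
      then have "cls (a (ia \<alpha>)) = cls x" using ia \<alpha> by simp
      then have "finite (x - a (ia \<alpha>))" unfolding cls_eq_iff by simp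
      then obtain m where m: "x - a (ia \<alpha>) \<subseteq> {..<m}" using finite_nat_iff_bounded by blast
      have "ia \<alpha> \<in> H" using H(3) \<alpha>(1) unfolding G_def by force
      have "n < max k m" if n: "n \<in> x" "(s, q) \<in> r" "f_not r (f_mem r n d) s" for n s
      proof (rule ccontr)
        assume "\<not> n < max k m"
        then have "n \<in> a (ia \<alpha>)" "k \<le> n" using m n(1) by auto
        then have "f_mem r n d q" using memI H \<open>ia \<alpha> \<in> H\<close> by blast
        then have "f_mem r n d s" using n(2) by (rule f_mem_mono)
        moreover have "(s, s) \<in> r" using n(2) field refl by blast
        ultimately show False using n(3) unfolding f_not_def by blast
      qed
      then show "\<exists>k. \<forall>n\<in>x. \<forall>s. (s, q) \<in> r \<longrightarrow> f_not r (f_mem r n d) s \<longrightarrow> n < k" by blast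
    next
      fix \<alpha> \<beta> y assume \<beta>: "(\<alpha>, \<beta>) \<in> F" "cls y = \<beta>"
      then have "\<beta> \<in> B" using \<F> F by blast
      then have "cls (b (ib \<beta>)) = cls y" using ib \<beta> by simp
      then have "finite (y - b (ib \<beta>))" unfolding cls_eq_iff by simp
      then obtain m where m: "y - b (ib \<beta>) \<subseteq> {..<m}" using finite_nat_iff_bounded by blast
      have "ib \<beta> \<in> H" using H(3) \<beta>(1) unfolding G_def by force
      have "n < max k m" if n: "n \<in> y" "(s, q) \<in> r" "f_mem r n d s" for n s
      proof (cases "n \<in> b (ib \<beta>)")
        case True
        obtain K where "K \<in> Q" "s = e K" "H \<subseteq> K" using rE n(2) H by blast
        then show ?thesis using not_mem[of K "ib \<beta>" n] n(3) True \<open>ib \<beta> \<in> H\<close> by auto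
      next
        case False
        then show ?thesis using m n(1) by auto
      qed
      then show "\<exists>k. \<forall>n\<in>y. \<forall>s. (s, q) \<in> r \<longrightarrow> f_mem r n d s \<longrightarrow> n < k" by blast
    qed
  qed

  have "\<exists>p\<in>e ` Q. f_not r (f_countable r (\<lambda>F. f_and (f_ground (F \<in> \<F>)) (f_interpolates r d F))) p"
  proof (rule ccc_forces_uncountable[OF \<open>ccc r\<close> unc, where g = "\<lambda>F. e (G F)"])
    fix F assume "F \<in> {F \<in> \<F>. homogeneous I a b k (G F)}"
    then have F: "F \<in> \<F>" "G F \<in> Q" using G unfolding Q_def by auto
    then show "e (G F) \<in> e ` Q" by blast
    show "f_and (f_ground (F \<in> \<F>)) (f_interpolates r d F) q" if "(q, e (G F)) \<in> r" for q
      using F interp that unfolding f_and_def f_ground_def by blast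
  qed
  then obtain p where p: "p \<in> e ` Q"
    "f_not r (f_countable r (\<lambda>F. f_and (f_ground (F \<in> \<F>)) (f_interpolates r d F))) p" by blast
  have "f_and (f_aleph1_preserved r) (f_ex r (\<lambda>d :: (nat, 'p) name.
      f_not r (f_countable r (\<lambda>F. f_and (f_ground (F \<in> \<F>)) (f_interpolates r d F))))) p"
    unfolding f_and_def[of "f_aleph1_preserved r"]
  proof (intro conjI f_exI exI[of _ d])
    show "f_aleph1_preserved r p" by (rule ccc_preserves_aleph1[OF \<open>ccc r\<close>])
    show "f_not r (f_countable r (\<lambda>F. f_and (f_ground (F \<in> \<F>)) (f_interpolates r d F))) q"
      if "(q, p) \<in> r" for q
      using p(2) that by (rule f_not_mono)
  qed
  with \<open>preorder_on (e ` Q) r\<close> p(1) show "\<exists>(P :: 'p set) r p. preorder_on P r \<and> p \<in> P \<and>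
      f_and (f_aleph1_preserved r) (f_ex r (\<lambda>d :: (nat, 'p) name.
        f_not r (f_countable r (\<lambda>F. f_and (f_ground (F \<in> \<F>)) (f_interpolates r d F))))) p"
    by blast
qed

theorem mainTheorem4:
  fixes A B :: "pnfin set"
  assumes "pregap A B"
    and "A = {} \<longleftrightarrow> B = {}"
    and "\<exists>f :: nat set \<Rightarrow> 'i. inj f"
    and "\<exists>g :: nat set \<Rightarrow> 'p. inj g"
  shows "(souslin TYPE('p) A B \<longleftrightarrow>
            (\<forall>(I :: 'i set) a b. indexing A B I a b \<longrightarrow> ccc (homog_poset I a b 0))) \<and>
         (souslin TYPE('p) A B \<longleftrightarrow>
            (\<exists>(I :: 'i set) a b. indexing A B I a b \<and> (\<forall>k. ccc (homog_poset I a b k))))"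
    (is "(?a \<longleftrightarrow> ?b) \<and> (?a \<longleftrightarrow> ?c)")
proof -
  have "?b" if ?a
    using souslin_imp_ccc[OF that] by blast
  \<comment> \<open>\<open>?b\<close> speaks only of existing indexings; the assumptions on
    emptiness and on \<open>'i\<close> supply one, and truncation preserves its classes.\<close>
  moreover have "?c" if b: ?b
  proof -
    obtain I :: "'i set" and a b where ind: "indexing A B I a b"
      using ex_indexing[OF assms(2,3)] by blast
    have "ccc (homog_poset I a b k)" for k
      unfolding homog_poset_truncate[of I a b k] using b indexing_truncate[OF ind] by blast
    with ind show ?c by blast
  qed
  moreover have "?a" if c: ?c
    using c ccc_imp_souslin[OF assms(1,4)] by blast
  ultimately show ?thesis by blast
qed

end
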